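(* Let $K$ and $S$ be Kleene algebras. If the semiring reducts of $K$ and $S$ are Morita-equivalent via semiring bimodules, then $K$ and $S$ are Morita-equivalent via Kleene bimodules. Explicitly: if there exist a semiring $(K,S)$-bimodule $P$ and a semiring $(S,K)$-bimodule $Q$ with $P\otimes_S Q\cong {}_KK_K$ and $Q\otimes_K P\cong {}_SS_S$ as bimodules, then there exist a Kleene $(K,S)$-bimodule $M$ and a Kleene $(S,K)$-bimodule $N$ with $M\otimes_S N\cong {}_KK_K$ and $N\otimes_K M\cong {}_SS_S$ as bimodules.
   Context: A semiring $\langle S,+,\cdot,0,1\rangle$ is unital: $\langle S,+,0\rangle$ is a commutative monoid, $\langle S,\cdot,1\rangle$ is a monoid, $s0=0s=0$ for all $s$, and multiplication distributes over addition on both sides. A left module over a semiring $S$ is a commutative monoid $\langle M,+,0\rangle$ with a map $S\times M\to M$ satisfying $s(m+n)=sm+sn$, $(s+t)m=sm+tm$, $s(tm)=(st)m$, $1m=m$, $0m=0$; right modules are defined symmetrically. An $(S,T)$-bimodule is a left $S$-module and right $T$-module on the same commutative monoid with $s(mt)=(sm)t$. Homomorphisms are maps preserving addition and the scalar action(s); isomorphisms are invertible homomorphisms. A Kleene algebra is an additively idempotent semiring $K$ ($x+x=x$), ordered by $x\le y\iff x+y=y$, with a unary operation $*$ such that for all $x,y,z$: $1+xx^*=1+x^*x=x^*$; if $x+yz\le z$ then $y^*x\le z$; if $x+zy\le z$ then $xy^*\le z$. Its semiring reduct is obtained by forgetting $*$. Modules over an additively idempotent semiring are additively idempotent and are ordered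 in the same way. A left Kleene module over $K$ is a left module $M$ over the semiring reduct of $K$ such that $am\le m\Rightarrow a^*m\le m$ for all $a\in K$, $m\in M$; a right Kleene module is defined symmetrically ($ma\le m\Rightarrow ma^*\le m$). A Kleene $(K,L)$-bimodule is a semiring $(K,L)$-bimodule that is both a left Kleene module over $K$ and a right Kleene module over $L$. Tensor product: for an $(A,B)$-bimodule $M$ and a $(B,C)$-bimodule $N$, $M\otimes_B N$ is the quotient of the commutative monoid of finite formal sums of pairs $(m,n)\in M\times N$ by the least congruence under which the class $m\otimes n$ of $(m,n)$ is additive in each variable (with $0\otimes n=m\otimes 0=0$) and $B$-balanced, $mb\otimes n=m\otimes bn$; it is an $(A,C)$-bimodule via $a(m\otimes n)=(am)\otimes n$ and $(m\otimes n)c=m\otimes(nc)$. ${}_KK_K$ denotes $K$ as a bimodule over itself by multiplication. *)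

theory Defs
  imports "HOL-Algebra.Module" "HOL-Library.Multiset"
begin

text \<open>The semiring reduct needs no operation of its own: every predicate stated for
  ring records below ignores the additional field \<open>star\<close>.\<close>

record 'a kleene_algebra = "'a ring" +
  star :: "'a \<Rightarrow> 'a" (\<open>_\<^sup>\<star>\<index>\<close> [1000] 1000)

definition sum_le :: "('a, 'x) ring_scheme \<Rightarrow> 'a \<Rightarrow> 'a \<Rightarrow> bool" (infixl \<open>\<preceq>\<index>\<close> 50)
  where "x \<preceq>\<^bsub>G\<^esub> y \<longleftrightarrow> x \<oplus>\<^bsub>G\<^esub> y = y"

locale kleene_algebra = semiring K for K (structure) +
  assumes add_idem: "x \<in> carrier K \<Longrightarrow> x \<oplus> x = x"
    and star_closed: "x \<in> carrier K \<Longrightarrow> x\<^sup>\<star> \<in> carrier K"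
    and star_unfold_r: "x \<in> carrier K \<Longrightarrow> \<one> \<oplus> x \<otimes> x\<^sup>\<star> = x\<^sup>\<star>"
    and star_unfold_l: "x \<in> carrier K \<Longrightarrow> \<one> \<oplus> x\<^sup>\<star> \<otimes> x = x\<^sup>\<star>"
    and star_induct_l: "\<lbrakk>x \<in> carrier K; y \<in> carrier K; z \<in> carrier K; x \<oplus> y \<otimes> z \<preceq> z\<rbrakk>
      \<Longrightarrow> y\<^sup>\<star> \<otimes> x \<preceq> z"
    and star_induct_r: "\<lbrakk>x \<in> carrier K; y \<in> carrier K; z \<in> carrier K; x \<oplus> z \<otimes> y \<preceq> z\<rbrakk>
      \<Longrightarrow> x \<otimes> y\<^sup>\<star> \<preceq> z"

text \<open>The library's locale \<open>module\<close> requires a commutative ring and an abelian group, so only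
  its record type is reused. As there, the record fields \<open>mult\<close> and \<open>one\<close> of a module carry no
  meaning; nor does \<open>smult\<close> in a right module.\<close>

record ('a, 'm, 'b) bimodule = "('a, 'm) module" +
  rsmult :: "'m \<Rightarrow> 'b \<Rightarrow> 'm" (infixl \<open>\<odot>\<^sub>r\<index>\<close> 70)

locale left_module = R: semiring R + M: abelian_monoid M
  for R and M :: "('a, 'm, 'x) module_scheme" +
  assumes smult_closed: "\<lbrakk>a \<in> carrier R; m \<in> carrier M\<rbrakk> \<Longrightarrow> a \<odot>\<^bsub>M\<^esub> m \<in> carrier M"
    and smult_add: "\<lbrakk>a \<in> carrier R; m \<in> carrier M; n \<in> carrier M\<rbrakk>
      \<Longrightarrow> a \<odot>\<^bsub>M\<^esub> (m \<oplus>\<^bsub>M\<^esub> n) = a \<odot>\<^bsub>M\<^esub> m \<oplus>\<^bsub>M\<^esub> a \<odot>\<^bsub>M\<^esub> n"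
    and add_smult: "\<lbrakk>a \<in> carrier R; b \<in> carrier R; m \<in> carrier M\<rbrakk>
      \<Longrightarrow> (a \<oplus>\<^bsub>R\<^esub> b) \<odot>\<^bsub>M\<^esub> m = a \<odot>\<^bsub>M\<^esub> m \<oplus>\<^bsub>M\<^esub> b \<odot>\<^bsub>M\<^esub> m"
    and mult_smult: "\<lbrakk>a \<in> carrier R; b \<in> carrier R; m \<in> carrier M\<rbrakk>
      \<Longrightarrow> a \<odot>\<^bsub>M\<^esub> (b \<odot>\<^bsub>M\<^esub> m) = (a \<otimes>\<^bsub>R\<^esub> b) \<odot>\<^bsub>M\<^esub> m"
    and one_smult: "m \<in> carrier M \<Longrightarrow> \<one>\<^bsub>R\<^esub> \<odot>\<^bsub>M\<^esub> m = m"
    and zero_smult: "m \<in> carrier M \<Longrightarrow> \<zero>\<^bsub>R\<^esub> \<odot>\<^bsub>M\<^esub> m = \<zero>\<^bsub>M\<^esub>"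

locale right_module = R: semiring R + M: abelian_monoid M
  for R and M :: "('a, 'm, 'b, 'x) bimodule_scheme" +
  assumes rsmult_closed: "\<lbrakk>a \<in> carrier R; m \<in> carrier M\<rbrakk> \<Longrightarrow> m \<odot>\<^sub>r\<^bsub>M\<^esub> a \<in> carrier M"
    and add_rsmult: "\<lbrakk>a \<in> carrier R; m \<in> carrier M; n \<in> carrier M\<rbrakk>
      \<Longrightarrow> (m \<oplus>\<^bsub>M\<^esub> n) \<odot>\<^sub>r\<^bsub>M\<^esub> a = m \<odot>\<^sub>r\<^bsub>M\<^esub> a \<oplus>\<^bsub>M\<^esub> n \<odot>\<^sub>r\<^bsub>M\<^esub> a"
    and rsmult_add: "\<lbrakk>a \<in> carrier R; b \<in> carrier R; m \<in> carrier M\<rbrakk>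
      \<Longrightarrow> m \<odot>\<^sub>r\<^bsub>M\<^esub> (a \<oplus>\<^bsub>R\<^esub> b) = m \<odot>\<^sub>r\<^bsub>M\<^esub> a \<oplus>\<^bsub>M\<^esub> m \<odot>\<^sub>r\<^bsub>M\<^esub> b"
    and rsmult_mult: "\<lbrakk>a \<in> carrier R; b \<in> carrier R; m \<in> carrier M\<rbrakk>
      \<Longrightarrow> (m \<odot>\<^sub>r\<^bsub>M\<^esub> a) \<odot>\<^sub>r\<^bsub>M\<^esub> b = m \<odot>\<^sub>r\<^bsub>M\<^esub> (a \<otimes>\<^bsub>R\<^esub> b)"
    and rsmult_one: "m \<in> carrier M \<Longrightarrow> m \<odot>\<^sub>r\<^bsub>M\<^esub> \<one>\<^bsub>R\<^esub> = m"
    and rsmult_zero: "m \<in> carrier M \<Longrightarrow> m \<odot>\<^sub>r\<^bsub>M\<^esub> \<zero>\<^bsub>R\<^esub> = \<zero>\<^bsub>M\<^esub>"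

locale bimodule = left_module A M + right_module B M
  for A and B and M :: "('a, 'm, 'b, 'x) bimodule_scheme" +
  assumes smult_rsmult: "\<lbrakk>a \<in> carrier A; m \<in> carrier M; b \<in> carrier B\<rbrakk>
    \<Longrightarrow> a \<odot>\<^bsub>M\<^esub> (m \<odot>\<^sub>r\<^bsub>M\<^esub> b) = (a \<odot>\<^bsub>M\<^esub> m) \<odot>\<^sub>r\<^bsub>M\<^esub> b"

definition regular_bimodule :: "('a, 'x) ring_scheme \<Rightarrow> ('a, 'a, 'a) bimodule"
  where "regular_bimodule R =
    \<lparr>carrier = carrier R, monoid.mult = monoid.mult R, one = one R, zero = zero R, add = add R,
     smult = monoid.mult R, rsmult = monoid.mult R\<rparr>"

definition bimodule_hom :: "('a, 'x) ring_scheme \<Rightarrow> ('b, 'y) ring_scheme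
    \<Rightarrow> ('a, 'm, 'b) bimodule \<Rightarrow> ('a, 'n, 'b) bimodule \<Rightarrow> ('m \<Rightarrow> 'n) set"
  where "bimodule_hom A B M N = {f \<in> carrier M \<rightarrow> carrier N.
    (\<forall>m\<in>carrier M. \<forall>m'\<in>carrier M. f (m \<oplus>\<^bsub>M\<^esub> m') = f m \<oplus>\<^bsub>N\<^esub> f m') \<and>
    (\<forall>a\<in>carrier A. \<forall>m\<in>carrier M. f (a \<odot>\<^bsub>M\<^esub> m) = a \<odot>\<^bsub>N\<^esub> f m) \<and>
    (\<forall>m\<in>carrier M. \<forall>b\<in>carrier B. f (m \<odot>\<^sub>r\<^bsub>M\<^esub> b) = f m \<odot>\<^sub>r\<^bsub>N\<^esub> b)}"

definition bimodule_isomorphic :: "('a, 'x) ring_scheme \<Rightarrow> ('b, 'y) ring_scheme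
    \<Rightarrow> ('a, 'm, 'b) bimodule \<Rightarrow> ('a, 'n, 'b) bimodule \<Rightarrow> bool"
  where "bimodule_isomorphic A B M N \<longleftrightarrow>
    (\<exists>f\<in>bimodule_hom A B M N. \<exists>g\<in>bimodule_hom A B N M.
      (\<forall>m\<in>carrier M. g (f m) = m) \<and> (\<forall>n\<in>carrier N. f (g n) = n))"

locale left_kleene_module = kleene_algebra K + left_module K M
  for K and M :: "('a, 'm, 'x) module_scheme" +
  assumes star_smult: "\<lbrakk>a \<in> carrier K; m \<in> carrier M; a \<odot>\<^bsub>M\<^esub> m \<preceq>\<^bsub>M\<^esub> m\<rbrakk>
    \<Longrightarrow> (a\<^sup>\<star>\<^bsub>K\<^esub>) \<odot>\<^bsub>M\<^esub> m \<preceq>\<^bsub>M\<^esub> m"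

locale right_kleene_module = kleene_algebra K + right_module K M
  for K and M :: "('a, 'm, 'b, 'x) bimodule_scheme" +
  assumes rsmult_star: "\<lbrakk>a \<in> carrier K; m \<in> carrier M; m \<odot>\<^sub>r\<^bsub>M\<^esub> a \<preceq>\<^bsub>M\<^esub> m\<rbrakk>
    \<Longrightarrow> m \<odot>\<^sub>r\<^bsub>M\<^esub> (a\<^sup>\<star>\<^bsub>K\<^esub>) \<preceq>\<^bsub>M\<^esub> m"

locale kleene_bimodule = bimodule K L M + left: left_kleene_module K M + right: right_kleene_module L M
  for K and L and M :: "('a, 'm, 'b, 'x) bimodule_scheme"

text \<open>A finite formal sum of pairs is a multiset of pairs from the carriers.\<close>

definition formal_sums :: "('a, 'm, 'b) bimodule \<Rightarrow> ('b, 'n, 'c) bimodule \<Rightarrow> ('m \<times> 'n) multiset set"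
  where "formal_sums M N = {x. set_mset x \<subseteq> carrier M \<times> carrier N}"

inductive tensor_cong :: "('b, 'x) ring_scheme \<Rightarrow> ('a, 'm, 'b) bimodule \<Rightarrow> ('b, 'n, 'c) bimodule
    \<Rightarrow> ('m \<times> 'n) multiset \<Rightarrow> ('m \<times> 'n) multiset \<Rightarrow> bool"
  for B M N where
  tensor_refl: "x \<in> formal_sums M N \<Longrightarrow> tensor_cong B M N x x"
| tensor_sym: "tensor_cong B M N x y \<Longrightarrow> tensor_cong B M N y x"
| tensor_trans: "\<lbrakk>tensor_cong B M N x y; tensor_cong B M N y z\<rbrakk> \<Longrightarrow> tensor_cong B M N x z"
| tensor_plus: "\<lbrakk>tensor_cong B M N x x'; tensor_cong B M N y y'\<rbrakk> \<Longrightarrow> tensor_cong B M N (x + y) (x' + y')"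
| tensor_add_left: "\<lbrakk>m \<in> carrier M; m' \<in> carrier M; n \<in> carrier N\<rbrakk>
    \<Longrightarrow> tensor_cong B M N {#(m \<oplus>\<^bsub>M\<^esub> m', n)#} {#(m, n), (m', n)#}"
| tensor_add_right: "\<lbrakk>m \<in> carrier M; n \<in> carrier N; n' \<in> carrier N\<rbrakk>
    \<Longrightarrow> tensor_cong B M N {#(m, n \<oplus>\<^bsub>N\<^esub> n')#} {#(m, n), (m, n')#}"
| tensor_zero_left: "n \<in> carrier N \<Longrightarrow> tensor_cong B M N {#(\<zero>\<^bsub>M\<^esub>, n)#} {#}"
| tensor_zero_right: "m \<in> carrier M \<Longrightarrow> tensor_cong B M N {#(m, \<zero>\<^bsub>N\<^esub>)#} {#}"
| tensor_balanced: "\<lbrakk>m \<in> carrier M; b \<in> carrier B; n \<in> carrier N\<rbrakk>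
    \<Longrightarrow> tensor_cong B M N {#(m \<odot>\<^sub>r\<^bsub>M\<^esub> b, n)#} {#(m, b \<odot>\<^bsub>N\<^esub> n)#}"

definition tensor_rel :: "('b, 'x) ring_scheme \<Rightarrow> ('a, 'm, 'b) bimodule \<Rightarrow> ('b, 'n, 'c) bimodule
    \<Rightarrow> ('m \<times> 'n) multiset rel"
  where "tensor_rel B M N = {(x, y). tensor_cong B M N x y}"

text \<open>Elements are congruence classes. The operations are those on formal sums, applied to all
  representatives; that this is again a single class is part of lemma \<open>bimodule_tensor\<close> below
  (see also \<open>tensor_class_ops\<close>).\<close>

definition tensor :: "('b, 'x) ring_scheme \<Rightarrow> ('a, 'm, 'b) bimodule \<Rightarrow> ('b, 'n, 'c) bimodule
    \<Rightarrow> ('a, ('m \<times> 'n) multiset set, 'c) bimodule"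
  where "tensor B M N =
    \<lparr>carrier = formal_sums M N // tensor_rel B M N,
     monoid.mult = undefined,
     one = undefined,
     zero = tensor_rel B M N `` {{#}},
     add = (\<lambda>X Y. tensor_rel B M N `` {x + y | x y. x \<in> X \<and> y \<in> Y}),
     smult = (\<lambda>a X. tensor_rel B M N `` (image_mset (\<lambda>(m, n). (a \<odot>\<^bsub>M\<^esub> m, n)) ` X)),
     rsmult = (\<lambda>X c. tensor_rel B M N `` (image_mset (\<lambda>(m, n). (m, n \<odot>\<^sub>r\<^bsub>N\<^esub> c)) ` X))\<rparr>"

lemma (in semiring) bimodule_regular: "bimodule R R (regular_bimodule R)"
  by unfold_locales
    (auto simp: regular_bimodule_def l_distr r_distr m_assoc a_assoc a_comm a_lcomm Units_def
      intro!: exI[of _ "\<zero>"])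

lemma (in kleene_algebra) kleene_bimodule_regular: "kleene_bimodule K K (regular_bimodule K)"
proof -
  interpret bimodule K K "regular_bimodule K" by (rule bimodule_regular)
  show ?thesis
  proof
    fix a m
    assume *: "a \<in> carrier K" "m \<in> carrier (regular_bimodule K)"
    then have m: "m \<in> carrier K" by (simp add: regular_bimodule_def)
    show "(a\<^sup>\<star>) \<odot>\<^bsub>regular_bimodule K\<^esub> m \<preceq>\<^bsub>regular_bimodule K\<^esub> m"
      if "a \<odot>\<^bsub>regular_bimodule K\<^esub> m \<preceq>\<^bsub>regular_bimodule K\<^esub> m"
      using that star_induct_l[of m a m] * m
      by (simp add: regular_bimodule_def sum_le_def a_assoc add_idem)
    show "m \<odot>\<^sub>r\<^bsub>regular_bimodule K\<^esub> (a\<^sup>\<star>) \<preceq>\<^bsub>regular_bimodule K\<^esub> m"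
      if "m \<odot>\<^sub>r\<^bsub>regular_bimodule K\<^esub> a \<preceq>\<^bsub>regular_bimodule K\<^esub> m"
      using that star_induct_r[of m a m] * m
      by (simp add: regular_bimodule_def sum_le_def a_assoc add_idem)
  qed
qed

lemma tensor_cong_formal_sums:
  assumes "bimodule A B M" "bimodule B C N" "tensor_cong B M N x y"
  shows "x \<in> formal_sums M N \<and> y \<in> formal_sums M N"
proof -
  interpret M: bimodule A B M by fact
  interpret N: bimodule B C N by fact
  show ?thesis using assms(3)
    by induction (auto simp: formal_sums_def M.rsmult_closed N.smult_closed)
qed

lemma equiv_tensor_rel:
  assumes "bimodule A B M" "bimodule B C N"
  shows "equiv (formal_sums M N) (tensor_rel B M N)"
proof (rule equivI)
  show "tensor_rel B M N \<subseteq> formal_sums M N \<times> formal_sums M N"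
    using tensor_cong_formal_sums[OF assms] by (auto simp: tensor_rel_def)
  show "refl_on (formal_sums M N) (tensor_rel B M N)"
    by (auto simp: refl_on_def tensor_rel_def intro: tensor_refl)
  show "Relation.sym (tensor_rel B M N)"
    by (auto simp: sym_def tensor_rel_def intro: tensor_sym)
  show "Relation.trans (tensor_rel B M N)"
    by (auto simp: trans_def tensor_rel_def intro: tensor_trans)
qed

lemma tensor_cong_smult:
  assumes "bimodule A B M" "bimodule B C N" "tensor_cong B M N x y" "a \<in> carrier A"
  shows "tensor_cong B M N (image_mset (\<lambda>(m, n). (a \<odot>\<^bsub>M\<^esub> m, n)) x)
    (image_mset (\<lambda>(m, n). (a \<odot>\<^bsub>M\<^esub> m, n)) y)"
proof -
  interpret M: bimodule A B M by fact
  interpret N: bimodule B C N by fact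
  have zero: "a \<odot>\<^bsub>M\<^esub> \<zero>\<^bsub>M\<^esub> = \<zero>\<^bsub>M\<^esub>"
    using M.mult_smult[of a "\<zero>\<^bsub>A\<^esub>" "\<zero>\<^bsub>M\<^esub>"] M.zero_smult[of "\<zero>\<^bsub>M\<^esub>"] assms(4) by simp
  show ?thesis using assms(3)
  proof induction
    case (tensor_refl x)
    show ?case
      by (rule tensor_cong.tensor_refl)
        (use tensor_refl assms(4) in \<open>fastforce simp: formal_sums_def M.smult_closed\<close>)
  qed (use assms(4) in \<open>auto simp: M.smult_closed M.smult_add M.smult_rsmult zero
        intro: tensor_cong.intros\<close>)
qed

lemma tensor_cong_rsmult:
  assumes "bimodule A B M" "bimodule B C N" "tensor_cong B M N x y" "c \<in> carrier C"
  shows "tensor_cong B M N (image_mset (\<lambda>(m, n). (m, n \<odot>\<^sub>r\<^bsub>N\<^esub> c)) x)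
    (image_mset (\<lambda>(m, n). (m, n \<odot>\<^sub>r\<^bsub>N\<^esub> c)) y)"
proof -
  interpret M: bimodule A B M by fact
  interpret N: bimodule B C N by fact
  have zero: "\<zero>\<^bsub>N\<^esub> \<odot>\<^sub>r\<^bsub>N\<^esub> c = \<zero>\<^bsub>N\<^esub>"
    using N.rsmult_mult[of "\<zero>\<^bsub>C\<^esub>" c "\<zero>\<^bsub>N\<^esub>"] N.rsmult_zero[of "\<zero>\<^bsub>N\<^esub>"] assms(4) by simp
  show ?thesis using assms(3)
  proof induction
    case (tensor_refl x)
    show ?case
      by (rule tensor_cong.tensor_refl)
        (use tensor_refl assms(4) in \<open>fastforce simp: formal_sums_def N.rsmult_closed\<close>)
  qed (use assms(4) in \<open>auto simp: N.rsmult_closed N.add_rsmult N.smult_rsmult[symmetric] zero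
        intro: tensor_cong.intros\<close>)
qed

lemma tensor_class_ops:
  assumes "bimodule A B M" "bimodule B C N" "x \<in> formal_sums M N" "y \<in> formal_sums M N"
  shows "tensor_rel B M N `` {x} \<oplus>\<^bsub>tensor B M N\<^esub> tensor_rel B M N `` {y} = tensor_rel B M N `` {x + y}"
    and "a \<in> carrier A \<Longrightarrow> a \<odot>\<^bsub>tensor B M N\<^esub> tensor_rel B M N `` {x}
      = tensor_rel B M N `` {image_mset (\<lambda>(m, n). (a \<odot>\<^bsub>M\<^esub> m, n)) x}"
    and "c \<in> carrier C \<Longrightarrow> tensor_rel B M N `` {x} \<odot>\<^sub>r\<^bsub>tensor B M N\<^esub> c
      = tensor_rel B M N `` {image_mset (\<lambda>(m, n). (m, n \<odot>\<^sub>r\<^bsub>N\<^esub> c)) x}"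
proof -
  note refls = assms(3,4)[THEN tensor_refl[where B = B]]
  show "tensor_rel B M N `` {x} \<oplus>\<^bsub>tensor B M N\<^esub> tensor_rel B M N `` {y} = tensor_rel B M N `` {x + y}"
    using refls by (auto simp: tensor_def tensor_rel_def)
      (blast intro: tensor_plus tensor_trans)+
  show "a \<odot>\<^bsub>tensor B M N\<^esub> tensor_rel B M N `` {x}
      = tensor_rel B M N `` {image_mset (\<lambda>(m, n). (a \<odot>\<^bsub>M\<^esub> m, n)) x}" if "a \<in> carrier A"
    using refls tensor_cong_smult[OF assms(1,2) _ that]
    by (auto simp: tensor_def tensor_rel_def) (blast intro: tensor_trans)+
  show "tensor_rel B M N `` {x} \<odot>\<^sub>r\<^bsub>tensor B M N\<^esub> c
      = tensor_rel B M N `` {image_mset (\<lambda>(m, n). (m, n \<odot>\<^sub>r\<^bsub>N\<^esub> c)) x}" if "c \<in> carrier C"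
    using refls tensor_cong_rsmult[OF assms(1,2) _ that]
    by (auto simp: tensor_def tensor_rel_def) (blast intro: tensor_trans)+
qed

lemma tensor_cong_image:
  assumes "x \<in> formal_sums M N"
    and "\<And>m n. \<lbrakk>m \<in> carrier M; n \<in> carrier N\<rbrakk> \<Longrightarrow> tensor_cong B M N {#f (m, n)#} (g (m, n))"
  shows "tensor_cong B M N (image_mset f x) (\<Sum>p\<in>#x. g p)"
  using assms(1)
proof (induction x)
  case empty
  show ?case by (simp add: tensor_refl formal_sums_def)
next
  case (add p x)
  obtain m n where p: "p = (m, n)" "m \<in> carrier M" "n \<in> carrier N"
    using add.prems by (cases p) (auto simp: formal_sums_def)
  have "tensor_cong B M N (image_mset f x) (\<Sum>p\<in>#x. g p)"
    using add by (auto simp: formal_sums_def)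
  then show ?case
    using tensor_plus[OF assms(2)[OF p(2,3)]] p(1) by simp
qed

lemma sum_mset_pair: "(\<Sum>p\<in>#x. {#f p, g p#}) = image_mset f x + image_mset g x"
  by (induction x) auto

lemma bimodule_tensor:
  assumes "bimodule A B M" "bimodule B C N"
  shows "bimodule A C (tensor B M N)"
proof -
  interpret M: bimodule A B M by fact
  interpret N: bimodule B C N by fact
  let ?F = "formal_sums M N" and ?T = "tensor B M N" and ?r = "tensor_rel B M N"
  let ?l = "\<lambda>a. image_mset (\<lambda>(m, n). (a \<odot>\<^bsub>M\<^esub> m, n))"
  let ?rr = "\<lambda>c. image_mset (\<lambda>(m, n). (m, n \<odot>\<^sub>r\<^bsub>N\<^esub> c))"
  note ops = tensor_class_ops[OF assms]
  have carrI: "?r `` {x} \<in> carrier ?T" if "x \<in> ?F" for x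
    using that by (auto simp: tensor_def quotient_def)
  have carrE: thesis if "X \<in> carrier ?T" "\<And>x. \<lbrakk>x \<in> ?F; X = ?r `` {x}\<rbrakk> \<Longrightarrow> thesis" for X thesis
    using that by (auto simp: tensor_def quotient_def)
  have zero: "\<zero>\<^bsub>?T\<^esub> = ?r `` {{#}}" by (simp add: tensor_def)
  have eqI: "?r `` {x} = ?r `` {y}" if "tensor_cong B M N x y" for x y
    using equiv_class_eq[OF equiv_tensor_rel[OF assms]] that by (simp add: tensor_rel_def)
  have F0: "{#} \<in> ?F" by (simp add: formal_sums_def)
  have Fp: "x + y \<in> ?F" if "x \<in> ?F" "y \<in> ?F" for x y
    using that by (simp add: formal_sums_def)
  have Fl: "?l a x \<in> ?F" if "a \<in> carrier A" "x \<in> ?F" for a x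
    using that by (fastforce simp: formal_sums_def M.smult_closed)
  have Fr: "?rr c x \<in> ?F" if "c \<in> carrier C" "x \<in> ?F" for c x
    using that by (fastforce simp: formal_sums_def N.rsmult_closed)
  have l_add: "?r `` {?l (a \<oplus>\<^bsub>A\<^esub> b) x} = ?r `` {?l a x + ?l b x}"
    if "a \<in> carrier A" "b \<in> carrier A" "x \<in> ?F" for a b x
    unfolding sum_mset_pair[symmetric] using that
    by (intro eqI tensor_cong_image)
      (auto simp: M.smult_closed M.add_smult intro: tensor_add_left)
  have r_add: "?r `` {?rr (a \<oplus>\<^bsub>C\<^esub> b) x} = ?r `` {?rr a x + ?rr b x}"
    if "a \<in> carrier C" "b \<in> carrier C" "x \<in> ?F" for a b x
    unfolding sum_mset_pair[symmetric] using that
    by (intro eqI tensor_cong_image)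
      (auto simp: N.rsmult_closed N.rsmult_add intro: tensor_add_right)
  have l_zero: "?r `` {?l \<zero>\<^bsub>A\<^esub> x} = ?r `` {{#}}" if "x \<in> ?F" for x
    using tensor_cong_image[OF that, of B "\<lambda>(m, n). (\<zero>\<^bsub>A\<^esub> \<odot>\<^bsub>M\<^esub> m, n)" "\<lambda>_. {#}"]
    by (auto simp: M.zero_smult intro: tensor_zero_left intro!: eqI)
  have r_zero: "?r `` {?rr \<zero>\<^bsub>C\<^esub> x} = ?r `` {{#}}" if "x \<in> ?F" for x
    using tensor_cong_image[OF that, of B "\<lambda>(m, n). (m, n \<odot>\<^sub>r\<^bsub>N\<^esub> \<zero>\<^bsub>C\<^esub>)" "\<lambda>_. {#}"]
    by (auto simp: N.rsmult_zero intro: tensor_zero_right intro!: eqI)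
  have l_mult: "?l a (?l b x) = ?l (a \<otimes>\<^bsub>A\<^esub> b) x"
    if "a \<in> carrier A" "b \<in> carrier A" "x \<in> ?F" for a b x
    using that
    by (auto simp: formal_sums_def M.mult_smult multiset.map_comp comp_def intro!: image_mset_cong)
  have r_mult: "?rr b (?rr a x) = ?rr (a \<otimes>\<^bsub>C\<^esub> b) x"
    if "a \<in> carrier C" "b \<in> carrier C" "x \<in> ?F" for a b x
    using that
    by (auto simp: formal_sums_def N.rsmult_mult multiset.map_comp comp_def intro!: image_mset_cong)
  have l_one: "?l \<one>\<^bsub>A\<^esub> x = x" if "x \<in> ?F" for x
    using that by (intro multiset.map_ident_strong) (auto simp: formal_sums_def M.one_smult)
  have r_one: "?rr \<one>\<^bsub>C\<^esub> x = x" if "x \<in> ?F" for x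
    using that by (intro multiset.map_ident_strong) (auto simp: formal_sums_def N.rsmult_one)
  have comm: "?l a (?rr c x) = ?rr c (?l a x)" for a c x
    by (simp add: multiset.map_comp comp_def case_prod_beta)
  interpret T: abelian_monoid ?T
    by (rule abelian_monoidI)
      (auto simp: carrI zero ops F0 Fp ac_simps elim!: carrE)
  show ?thesis
    by unfold_locales
      (auto simp: carrI zero ops F0 Fp Fl Fr l_add r_add l_zero r_zero l_mult r_mult l_one r_one comm
        elim!: carrE)
qed

end

(* The bimodules P and Q are themselves Kleene bimodules. Write phi and psi for the pairings
   P x Q -> K and Q x P -> S underlying the two isomorphisms. If phi(u,q) = phi(v,q) for all q, then
   u (x) q = v (x) q, and applying the balanced map (w,q) |-> w psi(q,p) gives
   u psi(q,p) = v psi(q,p) for all q and p; since the values of psi generate S additively, u = v.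
   So the left K-linear maps phi(-,q) from P to K separate points, and the Kleene law of K, which
   is an equation u = v once the order is unfolded, is reflected to P. The other three actions are
   symmetric. *)

theory Submission
  imports Defs
begin

section \<open>The order of an idempotent commutative monoid, and elementary module laws\<close>

context abelian_monoid
begin

lemma zero_sum_le: "x \<in> carrier G \<Longrightarrow> \<zero> \<preceq> x"
  by (simp add: sum_le_def)

lemma sum_le_antisym: "\<lbrakk>x \<preceq> y; y \<preceq> x; x \<in> carrier G; y \<in> carrier G\<rbrakk> \<Longrightarrow> x = y"
  using a_comm[of x y] by (simp add: sum_le_def)

text \<open>Idempotence makes a sum the least upper bound of its summands. Expanding
  \<open>z\<close> as the sum of \<open>x\<close>, \<open>y\<close> and \<open>z\<close> and adding
  \<open>x\<close> or \<open>y\<close> once more produces a repeated summand, which idempotence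
  absorbs.\<close>

lemma add_sum_le_iff:
  assumes "\<And>x. x \<in> carrier G \<Longrightarrow> x \<oplus> x = x"
    and "x \<in> carrier G" "y \<in> carrier G" "z \<in> carrier G"
  shows "x \<oplus> y \<preceq> z \<longleftrightarrow> x \<preceq> z \<and> y \<preceq> z"
proof
  assume "x \<oplus> y \<preceq> z"
  then have eq: "x \<oplus> (y \<oplus> z) = z"
    using assms(2-4) by (simp add: sum_le_def a_assoc)
  have "x \<oplus> z = x \<oplus> (x \<oplus> (y \<oplus> z))"
    unfolding eq ..
  also have "\<dots> = (x \<oplus> x) \<oplus> (y \<oplus> z)"
    using assms(2-4) by (intro a_assoc[symmetric]) auto
  also have "\<dots> = z"
    unfolding assms(1)[OF assms(2)] by (rule eq)
  finally have x: "x \<oplus> z = z" .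
  have "y \<oplus> z = y \<oplus> (y \<oplus> (x \<oplus> z))"
    using eq assms(2-4) by (metis a_lcomm add.m_closed)
  also have "\<dots> = (y \<oplus> y) \<oplus> (x \<oplus> z)"
    using assms(2-4) by (intro a_assoc[symmetric]) auto
  also have "\<dots> = x \<oplus> (y \<oplus> z)"
    unfolding assms(1)[OF assms(3)] using assms(2-4) by (intro a_lcomm)
  finally show "x \<preceq> z \<and> y \<preceq> z"
    using x eq by (simp add: sum_le_def)
qed (use assms(2-4) in \<open>simp add: sum_le_def a_assoc\<close>)

end

context kleene_algebra
begin

text \<open>Star induction with the same element as start and as bound: by idempotence the premise x
  + ax \<le> x reduces to ax \<le> x.\<close>

lemma star_mult_le:
  assumes "a \<in> carrier K" "x \<in> carrier K" "a \<otimes> x \<preceq> x"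
  shows "a\<^sup>\<star> \<otimes> x \<preceq> x"
  using assms star_induct_l[of x a x] by (simp add: sum_le_def a_assoc add_idem)

lemma mult_star_le:
  assumes "a \<in> carrier K" "x \<in> carrier K" "x \<otimes> a \<preceq> x"
  shows "x \<otimes> a\<^sup>\<star> \<preceq> x"
  using assms star_induct_r[of x a x] by (simp add: sum_le_def a_assoc add_idem)

end

lemma (in left_module) smult_zero: "a \<in> carrier R \<Longrightarrow> a \<odot>\<^bsub>M\<^esub> \<zero>\<^bsub>M\<^esub> = \<zero>\<^bsub>M\<^esub>"
  using mult_smult[of a "\<zero>\<^bsub>R\<^esub>" "\<zero>\<^bsub>M\<^esub>"] zero_smult[of "\<zero>\<^bsub>M\<^esub>"] by simp

lemma (in right_module) zero_rsmult: "a \<in> carrier R \<Longrightarrow> \<zero>\<^bsub>M\<^esub> \<odot>\<^sub>r\<^bsub>M\<^esub> a = \<zero>\<^bsub>M\<^esub>"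
  using rsmult_mult[of "\<zero>\<^bsub>R\<^esub>" a "\<zero>\<^bsub>M\<^esub>"] rsmult_zero[of "\<zero>\<^bsub>M\<^esub>"] by simp

text \<open>Idempotence passes from scalars to vectors: m = 1m = (1 + 1)m = m + m.\<close>

lemma left_module_add_idem:
  assumes "kleene_algebra K" "left_module K M" "m \<in> carrier M"
  shows "m \<oplus>\<^bsub>M\<^esub> m = m"
proof -
  interpret kleene_algebra K by fact
  interpret left_module K M by fact
  show ?thesis
    using add_smult[of "\<one>\<^bsub>K\<^esub>" "\<one>\<^bsub>K\<^esub>" m] assms(3) by (simp add: one_smult add_idem)
qed

section \<open>Balanced maps and the tensor congruence\<close>

locale balanced_map = M: abelian_monoid M + N: abelian_monoid N + G: abelian_monoid G
  for B :: "('b, 'x) ring_scheme" and M :: "('a, 'm, 'b) bimodule"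
    and N :: "('b, 'n, 'c) bimodule" and G :: "('g, 'y) ring_scheme" +
  fixes h :: "'m \<Rightarrow> 'n \<Rightarrow> 'g"
  assumes closed: "\<lbrakk>m \<in> carrier M; n \<in> carrier N\<rbrakk> \<Longrightarrow> h m n \<in> carrier G"
    and add_left: "\<lbrakk>m \<in> carrier M; m' \<in> carrier M; n \<in> carrier N\<rbrakk>
      \<Longrightarrow> h (m \<oplus>\<^bsub>M\<^esub> m') n = h m n \<oplus>\<^bsub>G\<^esub> h m' n"
    and add_right: "\<lbrakk>m \<in> carrier M; n \<in> carrier N; n' \<in> carrier N\<rbrakk>
      \<Longrightarrow> h m (n \<oplus>\<^bsub>N\<^esub> n') = h m n \<oplus>\<^bsub>G\<^esub> h m n'"
    and zero_left: "n \<in> carrier N \<Longrightarrow> h \<zero>\<^bsub>M\<^esub> n = \<zero>\<^bsub>G\<^esub>"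
    and zero_right: "m \<in> carrier M \<Longrightarrow> h m \<zero>\<^bsub>N\<^esub> = \<zero>\<^bsub>G\<^esub>"
    and balanced: "\<lbrakk>m \<in> carrier M; b \<in> carrier B; n \<in> carrier N\<rbrakk>
      \<Longrightarrow> h (m \<odot>\<^sub>r\<^bsub>M\<^esub> b) n = h m (b \<odot>\<^bsub>N\<^esub> n)"
begin

text \<open>In an idempotent monoid the value of the induced map at a formal sum is the supremum of the
  values at its summands, so well-definedness can be stated in terms of upper bounds.\<close>

lemma tensor_cong_upper_bounds:
  assumes "tensor_cong B M N x y" and "\<And>g. g \<in> carrier G \<Longrightarrow> g \<oplus>\<^bsub>G\<^esub> g = g"
    and "z \<in> carrier G"
  shows "(\<forall>(m, n)\<in>#x. h m n \<preceq>\<^bsub>G\<^esub> z) \<longleftrightarrow> (\<forall>(m, n)\<in>#y. h m n \<preceq>\<^bsub>G\<^esub> z)"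
  using assms(1)
proof induction
  case (tensor_plus x x' y y')
  then show ?case by (simp add: ball_Un)
qed (simp_all add: add_left add_right zero_left zero_right balanced closed assms(3)
      G.zero_sum_le G.add_sum_le_iff[OF assms(2)])

text \<open>The two values have the same upper bounds. By idempotence each is an upper bound of
  itself, hence of the other, and antisymmetry applies. This replaces constructing the induced map
  on the tensor product.\<close>

lemma tensor_cong_single_eq:
  assumes "tensor_cong B M N {#(m, n)#} {#(m', n')#}"
    and "\<And>g. g \<in> carrier G \<Longrightarrow> g \<oplus>\<^bsub>G\<^esub> g = g"
    and "m \<in> carrier M" "n \<in> carrier N" "m' \<in> carrier M" "n' \<in> carrier N"
  shows "h m n = h m' n'"
proof -
  have iff: "h m n \<preceq>\<^bsub>G\<^esub> z \<longleftrightarrow> h m' n' \<preceq>\<^bsub>G\<^esub> z" if "z \<in> carrier G" for z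
    using tensor_cong_upper_bounds[OF assms(1,2) that] by simp
  have refl: "g \<preceq>\<^bsub>G\<^esub> g" if "g \<in> carrier G" for g
    using assms(2)[OF that] by (simp add: sum_le_def)
  show ?thesis
    using iff[of "h m n"] iff[of "h m' n'"] refl closed assms(3-6)
    by (blast intro: G.sum_le_antisym)
qed

end

section \<open>Pairings obtained from tensor isomorphisms\<close>

text \<open>This is the isomorphism with the regular bimodule seen on pure tensors.
  \<open>faithful\<close> is its injectivity there; \<open>generating\<close> is its surjectivity,
  put as an induction principle over sums of values of the pairing.\<close>

locale tensor_pairing = M: bimodule A B M + N: bimodule B A N + balanced_map B M N A \<phi>
  for A :: "('a, 'x) ring_scheme" and B :: "('b, 'y) ring_scheme"
    and M :: "('a, 'm, 'b) bimodule" and N :: "('b, 'n, 'a) bimodule"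
    and \<phi> :: "'m \<Rightarrow> 'n \<Rightarrow> 'a" +
  assumes smult: "\<lbrakk>a \<in> carrier A; m \<in> carrier M; n \<in> carrier N\<rbrakk>
      \<Longrightarrow> \<phi> (a \<odot>\<^bsub>M\<^esub> m) n = a \<otimes>\<^bsub>A\<^esub> \<phi> m n"
    and rsmult: "\<lbrakk>a \<in> carrier A; m \<in> carrier M; n \<in> carrier N\<rbrakk>
      \<Longrightarrow> \<phi> m (n \<odot>\<^sub>r\<^bsub>N\<^esub> a) = \<phi> m n \<otimes>\<^bsub>A\<^esub> a"
    and faithful: "\<lbrakk>m \<in> carrier M; n \<in> carrier N; m' \<in> carrier M; n' \<in> carrier N;
        \<phi> m n = \<phi> m' n'\<rbrakk>
      \<Longrightarrow> tensor_cong B M N {#(m, n)#} {#(m', n')#}"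
    and generating: "\<lbrakk>a \<in> carrier A; X \<zero>\<^bsub>A\<^esub>;
        \<And>m n. \<lbrakk>m \<in> carrier M; n \<in> carrier N\<rbrakk> \<Longrightarrow> X (\<phi> m n);
        \<And>b c. \<lbrakk>b \<in> carrier A; c \<in> carrier A; X b; X c\<rbrakk> \<Longrightarrow> X (b \<oplus>\<^bsub>A\<^esub> c)\<rbrakk>
      \<Longrightarrow> X a"

lemma tensor_pairing_of_isomorphism:
  assumes "bimodule A B M" "bimodule B A N"
    and "bimodule_isomorphic A A (tensor B M N) (regular_bimodule A)"
  obtains \<phi> where "tensor_pairing A B M N \<phi>"
proof -
  interpret M: bimodule A B M by fact
  interpret N: bimodule B A N by fact
  let ?T = "tensor B M N"
  interpret T: bimodule A A ?T by (rule bimodule_tensor[OF assms(1,2)])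
  define cl where "cl x = tensor_rel B M N `` {x}" for x
  obtain f g where f: "f \<in> bimodule_hom A A ?T (regular_bimodule A)"
    and g: "g \<in> bimodule_hom A A (regular_bimodule A) ?T"
    and gf: "\<And>m. m \<in> carrier ?T \<Longrightarrow> g (f m) = m"
    and fg: "\<And>a. a \<in> carrier A \<Longrightarrow> f (g a) = a"
    using assms(3) by (auto simp: bimodule_isomorphic_def regular_bimodule_def)
  have f_closed: "f t \<in> carrier A" if "t \<in> carrier ?T" for t
    using f that by (auto simp: bimodule_hom_def regular_bimodule_def)
  have f_add: "f (t \<oplus>\<^bsub>?T\<^esub> u) = f t \<oplus>\<^bsub>A\<^esub> f u" if "t \<in> carrier ?T" "u \<in> carrier ?T" for t u
    using f that by (auto simp: bimodule_hom_def regular_bimodule_def)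
  have f_smult: "f (a \<odot>\<^bsub>?T\<^esub> t) = a \<otimes>\<^bsub>A\<^esub> f t" if "t \<in> carrier ?T" "a \<in> carrier A" for t a
    using f that by (auto simp: bimodule_hom_def regular_bimodule_def)
  have f_rsmult: "f (t \<odot>\<^sub>r\<^bsub>?T\<^esub> a) = f t \<otimes>\<^bsub>A\<^esub> a" if "t \<in> carrier ?T" "a \<in> carrier A" for t a
    using f that by (auto simp: bimodule_hom_def regular_bimodule_def)
  have g_closed: "g a \<in> carrier ?T" if "a \<in> carrier A" for a
    using g that by (auto simp: bimodule_hom_def regular_bimodule_def)
  have cl_closed: "cl x \<in> carrier ?T" if "x \<in> formal_sums M N" for x
    using that by (auto simp: cl_def tensor_def quotient_def)
  have cl_eq: "cl x = cl y" if "tensor_cong B M N x y" for x y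
    using equiv_class_eq[OF equiv_tensor_rel[OF assms(1,2)]] that
    by (simp add: cl_def tensor_rel_def)
  have sums: "{#} \<in> formal_sums M N"
    "\<And>m n x. add_mset (m, n) x \<in> formal_sums M N
      \<longleftrightarrow> m \<in> carrier M \<and> n \<in> carrier N \<and> x \<in> formal_sums M N"
    by (auto simp: formal_sums_def)
  have zero: "\<zero>\<^bsub>?T\<^esub> = cl {#}" by (simp add: tensor_def cl_def)
  note ops = tensor_class_ops(1)[OF assms(1,2), folded cl_def]
    tensor_class_ops(2,3)[OF assms(1,2) _ sums(1), folded cl_def]
  \<comment> \<open>\<open>bimodule_hom\<close> does not list preservation of zero; it follows from
    linearity, since the zero tensor is 0 times itself.\<close>
  have f_zero: "f (cl {#}) = \<zero>\<^bsub>A\<^esub>"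
    using f_smult[of "\<zero>\<^bsub>?T\<^esub>" "\<zero>\<^bsub>A\<^esub>"] f_closed[of "\<zero>\<^bsub>?T\<^esub>"] T.zero_smult[of "\<zero>\<^bsub>?T\<^esub>"]
      cl_closed[OF sums(1)] zero by simp
  have f_insert: "f (cl (add_mset (m, n) x)) = f (cl {#(m, n)#}) \<oplus>\<^bsub>A\<^esub> f (cl x)"
    if "m \<in> carrier M" "n \<in> carrier N" "x \<in> formal_sums M N" for m n x
  proof -
    have "cl (add_mset (m, n) x) = cl {#(m, n)#} \<oplus>\<^bsub>?T\<^esub> cl x"
      using that by (simp add: ops sums)
    then show ?thesis
      using that by (simp add: f_add cl_closed sums)
  qed
  show thesis
  \<comment> \<open>The pairing is the map sending m and n to the image under \<open>f\<close> of
    their pure tensor, the class of a one-element formal sum.\<close>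
  proof (rule that, unfold_locales)
    fix m n m' n'
    assume mn: "m \<in> carrier M" "n \<in> carrier N"
    show "f (cl {#(m, n)#}) \<in> carrier A"
      using mn by (simp add: f_closed cl_closed sums)
    show "f (cl {#(m \<oplus>\<^bsub>M\<^esub> m', n)#}) = f (cl {#(m, n)#}) \<oplus>\<^bsub>A\<^esub> f (cl {#(m', n)#})"
      if "m' \<in> carrier M"
      using mn that f_insert[of m n "{#(m', n)#}"] by (simp add: cl_eq[OF tensor_add_left] sums)
    show "f (cl {#(m, n \<oplus>\<^bsub>N\<^esub> n')#}) = f (cl {#(m, n)#}) \<oplus>\<^bsub>A\<^esub> f (cl {#(m, n')#})"
      if "n' \<in> carrier N"
      using mn that f_insert[of m n "{#(m, n')#}"] by (simp add: cl_eq[OF tensor_add_right] sums)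
    show "f (cl {#(m \<odot>\<^sub>r\<^bsub>M\<^esub> b, n)#}) = f (cl {#(m, b \<odot>\<^bsub>N\<^esub> n)#})" if "b \<in> carrier B" for b
      using mn that by (simp add: cl_eq[OF tensor_balanced])
    show "f (cl {#(a \<odot>\<^bsub>M\<^esub> m, n)#}) = a \<otimes>\<^bsub>A\<^esub> f (cl {#(m, n)#})" if "a \<in> carrier A" for a
      using mn that f_smult[of "cl {#(m, n)#}" a] by (simp add: ops cl_closed sums)
    show "f (cl {#(m, n \<odot>\<^sub>r\<^bsub>N\<^esub> a)#}) = f (cl {#(m, n)#}) \<otimes>\<^bsub>A\<^esub> a" if "a \<in> carrier A" for a
      using mn that f_rsmult[of "cl {#(m, n)#}" a] by (simp add: ops cl_closed sums)
    show "tensor_cong B M N {#(m, n)#} {#(m', n')#}"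
      if "m' \<in> carrier M" "n' \<in> carrier N" "f (cl {#(m, n)#}) = f (cl {#(m', n')#})"
    proof -
      \<comment> \<open>The inverse \<open>g\<close> cancels \<open>f\<close>, and equal classes of
        an equivalence relation have related representatives.\<close>
      have "cl {#(m, n)#} = cl {#(m', n')#}"
        using arg_cong[OF that(3), of g] by (simp add: gf cl_closed sums mn that(1,2))
      then have "({#(m, n)#}, {#(m', n')#}) \<in> tensor_rel B M N"
        unfolding cl_def
        by (rule eq_equiv_class[OF _ equiv_tensor_rel[OF assms(1,2)]]) (simp add: that(1,2) sums)
      then show ?thesis by (simp add: tensor_rel_def)
    qed
  next
    show "f (cl {#(\<zero>\<^bsub>M\<^esub>, n)#}) = \<zero>\<^bsub>A\<^esub>" if "n \<in> carrier N" for n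
      using cl_eq[OF tensor_zero_left[OF that]] by (simp add: f_zero)
    show "f (cl {#(m, \<zero>\<^bsub>N\<^esub>)#}) = \<zero>\<^bsub>A\<^esub>" if "m \<in> carrier M" for m
      using cl_eq[OF tensor_zero_right[OF that]] by (simp add: f_zero)
  next
    fix a X
    assume a: "a \<in> carrier A" and X0: "X \<zero>\<^bsub>A\<^esub>"
      and Xf: "\<And>m n. \<lbrakk>m \<in> carrier M; n \<in> carrier N\<rbrakk> \<Longrightarrow> X (f (cl {#(m, n)#}))"
      and Xadd: "\<And>b c. \<lbrakk>b \<in> carrier A; c \<in> carrier A; X b; X c\<rbrakk> \<Longrightarrow> X (b \<oplus>\<^bsub>A\<^esub> c)"
    \<comment> \<open>Every \<open>a\<close> is \<open>f (g a)\<close>, and \<open>g a\<close> is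
      the class of some formal sum, so induction on formal sums reaches all of
      \<open>A\<close>.\<close>
    have "X (f (cl x))" if "x \<in> formal_sums M N" for x
      using that
    proof (induction x)
      case empty
      show ?case by (simp add: f_zero X0)
    next
      case (add p x)
      then show ?case
        using f_insert[of "fst p" "snd p" x]
        by (cases p) (simp add: Xf Xadd f_closed cl_closed sums)
    qed
    moreover obtain x where "x \<in> formal_sums M N" "g a = cl x"
      using g_closed[OF a] by (auto simp: tensor_def quotient_def cl_def)
    ultimately show "X a" using fg[OF a] by metis
  qed
qed

section \<open>Separation of points and reflection of the Kleene laws\<close>

text \<open>The assumptions are symmetric under exchanging K with S, P with Q and \<phi> with
  \<psi>, so results about P also apply to Q.\<close>

locale morita_pairings = \<phi>: tensor_pairing K S P Q \<phi> + \<psi>: tensor_pairing S K Q P \<psi> +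
    K: kleene_algebra K + S: kleene_algebra S
  for K :: "'k kleene_algebra" and S :: "'s kleene_algebra"
    and P :: "('k, 'p, 's) bimodule" and Q :: "('s, 'q, 'k) bimodule"
    and \<phi> :: "'p \<Rightarrow> 'q \<Rightarrow> 'k" and \<psi> :: "'q \<Rightarrow> 'p \<Rightarrow> 's"
begin

lemma add_idem: "p \<in> carrier P \<Longrightarrow> p \<oplus>\<^bsub>P\<^esub> p = p"
  by (rule left_module_add_idem[OF K.kleene_algebra_axioms \<phi>.M.left_module_axioms])

lemma left_separating:
  assumes u: "u \<in> carrier P" and v: "v \<in> carrier P"
    and eq: "\<And>q. q \<in> carrier Q \<Longrightarrow> \<phi> u q = \<phi> v q"
  shows "u = v"
proof -
  have "u \<odot>\<^sub>r\<^bsub>P\<^esub> \<psi> q p = v \<odot>\<^sub>r\<^bsub>P\<^esub> \<psi> q p" if q: "q \<in> carrier Q" and p: "p \<in> carrier P" for q p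
  proof -
    \<comment> \<open>Balancedness is the left S-linearity of \<psi>: (ws)\<psi>(q,p) =
      w(s\<psi>(q,p)) = w\<psi>(sq,p).\<close>
    interpret balanced_map S P Q P "\<lambda>w q. w \<odot>\<^sub>r\<^bsub>P\<^esub> \<psi> q p"
      using p by unfold_locales
        (simp_all add: \<phi>.M.rsmult_closed \<phi>.M.add_rsmult \<phi>.M.rsmult_add \<phi>.M.rsmult_zero
          \<phi>.M.zero_rsmult \<phi>.M.rsmult_mult \<psi>.closed \<psi>.add_left \<psi>.zero_left \<psi>.smult)
    show ?thesis
      by (rule tensor_cong_single_eq[OF \<phi>.faithful add_idem]) (simp_all add: u v q eq)
  qed
  \<comment> \<open>The scalars on which u and v agree contain 0 and all values of \<psi> and are
    closed under sums, so they exhaust S; the scalar 1 then gives u = v.\<close>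
  then have "u \<odot>\<^sub>r\<^bsub>P\<^esub> s = v \<odot>\<^sub>r\<^bsub>P\<^esub> s" if "s \<in> carrier S" for s
    using that u v
    by (rule_tac \<psi>.generating[OF that]) (simp_all add: \<phi>.M.rsmult_add \<phi>.M.rsmult_zero)
  from this[of "\<one>\<^bsub>S\<^esub>"] show ?thesis using u v by (simp add: \<phi>.M.rsmult_one)
qed

text \<open>The mirror argument: equality of q (x) u and q (x) v is tested by (q,w) |-> \<phi>(p,q)w
  for fixed p, which is balanced because \<phi>(p,qk) = \<phi>(p,q)k. Here the values of \<phi>
  generate K.\<close>

lemma right_separating:
  assumes u: "u \<in> carrier P" and v: "v \<in> carrier P"
    and eq: "\<And>q. q \<in> carrier Q \<Longrightarrow> \<psi> q u = \<psi> q v"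
  shows "u = v"
proof -
  have "\<phi> p q \<odot>\<^bsub>P\<^esub> u = \<phi> p q \<odot>\<^bsub>P\<^esub> v" if p: "p \<in> carrier P" and q: "q \<in> carrier Q" for p q
  proof -
    interpret balanced_map K Q P P "\<lambda>q w. \<phi> p q \<odot>\<^bsub>P\<^esub> w"
      using p by unfold_locales
        (simp_all add: \<phi>.M.smult_closed \<phi>.M.add_smult \<phi>.M.smult_add \<phi>.M.smult_zero
          \<phi>.M.zero_smult \<phi>.M.mult_smult \<phi>.closed \<phi>.add_right \<phi>.zero_right \<phi>.rsmult)
    show ?thesis
      by (rule tensor_cong_single_eq[OF \<psi>.faithful add_idem]) (simp_all add: u v q eq)
  qed
  then have "k \<odot>\<^bsub>P\<^esub> u = k \<odot>\<^bsub>P\<^esub> v" if "k \<in> carrier K" for k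
    using that u v
    by (rule_tac \<phi>.generating[OF that]) (simp_all add: \<phi>.M.add_smult \<phi>.M.zero_smult)
  from this[of "\<one>\<^bsub>K\<^esub>"] show ?thesis using u v by (simp add: \<phi>.M.one_smult)
qed

lemma kleene_bimodule: "kleene_bimodule K S P"
proof unfold_locales
  fix a m
  assume a: "a \<in> carrier K" and m: "m \<in> carrier P" and le: "a \<odot>\<^bsub>P\<^esub> m \<preceq>\<^bsub>P\<^esub> m"
  note closed = a m K.star_closed \<phi>.closed \<phi>.M.smult_closed
  show "(a\<^sup>\<star>\<^bsub>K\<^esub>) \<odot>\<^bsub>P\<^esub> m \<preceq>\<^bsub>P\<^esub> m"
    unfolding sum_le_def
  \<comment> \<open>The inequality is an equation in P, so it can be checked after applying each
    \<phi>(-,q). These maps are left K-linear, which turns it into the star law for \<phi>(m,q) in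
    K.\<close>
  proof (rule left_separating)
    fix q
    assume q: "q \<in> carrier Q"
    have "a \<otimes>\<^bsub>K\<^esub> \<phi> m q \<preceq>\<^bsub>K\<^esub> \<phi> m q"
      using q le \<phi>.add_left[of "a \<odot>\<^bsub>P\<^esub> m" m q] by (simp add: sum_le_def closed \<phi>.smult)
    from K.star_mult_le[OF _ _ this]
    show "\<phi> ((a\<^sup>\<star>\<^bsub>K\<^esub>) \<odot>\<^bsub>P\<^esub> m \<oplus>\<^bsub>P\<^esub> m) q = \<phi> m q"
      using q by (simp add: sum_le_def closed \<phi>.smult \<phi>.add_left)
  qed (simp_all add: closed)
next
  fix a m
  assume a: "a \<in> carrier S" and m: "m \<in> carrier P" and le: "m \<odot>\<^sub>r\<^bsub>P\<^esub> a \<preceq>\<^bsub>P\<^esub> m"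
  note closed = a m S.star_closed \<psi>.closed \<phi>.M.rsmult_closed
  show "m \<odot>\<^sub>r\<^bsub>P\<^esub> (a\<^sup>\<star>\<^bsub>S\<^esub>) \<preceq>\<^bsub>P\<^esub> m"
    unfolding sum_le_def
  \<comment> \<open>The right action needs right S-linear maps, namely \<psi>(q,-) from P to
    S.\<close>
  proof (rule right_separating)
    fix q
    assume q: "q \<in> carrier Q"
    have "\<psi> q m \<otimes>\<^bsub>S\<^esub> a \<preceq>\<^bsub>S\<^esub> \<psi> q m"
      using q le \<psi>.add_right[of q "m \<odot>\<^sub>r\<^bsub>P\<^esub> a" m] by (simp add: sum_le_def closed \<psi>.rsmult)
    from S.mult_star_le[OF _ _ this]
    show "\<psi> q (m \<odot>\<^sub>r\<^bsub>P\<^esub> (a\<^sup>\<star>\<^bsub>S\<^esub>) \<oplus>\<^bsub>P\<^esub> m) = \<psi> q m"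
      using q by (simp add: sum_le_def closed \<psi>.rsmult \<psi>.add_right)
  qed (simp_all add: closed)
qed

end

theorem theorem22:
  fixes K :: "'k kleene_algebra" and S :: "'s kleene_algebra"
  assumes "kleene_algebra K" and "kleene_algebra S"
    and "\<exists>(P :: ('k, 'p, 's) bimodule) (Q :: ('s, 'q, 'k) bimodule).
      bimodule K S P \<and> bimodule S K Q \<and>
      bimodule_isomorphic K K (tensor S P Q) (regular_bimodule K) \<and>
      bimodule_isomorphic S S (tensor K Q P) (regular_bimodule S)"
  shows "\<exists>(M :: ('k, 'p, 's) bimodule) (N :: ('s, 'q, 'k) bimodule).
      kleene_bimodule K S M \<and> kleene_bimodule S K N \<and>
      bimodule_isomorphic K K (tensor S M N) (regular_bimodule K) \<and>
      bimodule_isomorphic S S (tensor K N M) (regular_bimodule S)"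
proof -
  obtain P :: "('k, 'p, 's) bimodule" and Q :: "('s, 'q, 'k) bimodule"
    where P: "bimodule K S P" and Q: "bimodule S K Q"
      and PQ: "bimodule_isomorphic K K (tensor S P Q) (regular_bimodule K)"
      and QP: "bimodule_isomorphic S S (tensor K Q P) (regular_bimodule S)"
    using assms(3) by blast
  obtain \<phi> where \<phi>: "tensor_pairing K S P Q \<phi>"
    by (rule tensor_pairing_of_isomorphism[OF P Q PQ])
  obtain \<psi> where \<psi>: "tensor_pairing S K Q P \<psi>"
    by (rule tensor_pairing_of_isomorphism[OF Q P QP])
  have "kleene_bimodule K S P"
    by (rule morita_pairings.kleene_bimodule[OF morita_pairings.intro[OF \<phi> \<psi> assms(1,2)]])
  \<comment> \<open>The same result with the two algebras, bimodules and pairings exchanged.\<close>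
  moreover have "kleene_bimodule S K Q"
    by (rule morita_pairings.kleene_bimodule[OF morita_pairings.intro[OF \<psi> \<phi> assms(2,1)]])
  ultimately show ?thesis using PQ QP by blast
qed

end
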